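(* Let $n\geq 2$ and let $S_n$ be either $\Sigma_n$ or $\Sigma_n^{*}$. Let $\ell\geq 2$ be an integer. Let $W_{\ell-1}$ and $W_{\ell-2}$ be sets of $S_n$-words representing $B_n(S_n,\ell-1)$ and $B_n(S_n,\ell-2)$ respectively, where each word $u\in W_{\ell-1}$ carries the integer label $u\cdot\omega=\omega_{S_n}(\overline{u})$. Run on $W_{\ell-1}$ and $W_{\ell-2}$, the algorithm RepSet returns a set $W_\ell$ representing $B_n(S_n,\ell)$. Moreover, for every $u\in W_\ell$, the value of the label $u\cdot\omega$ upon return is the integer $\omega_{S_n}(\overline{u})$.
   Context: $B_n$ is the braid group, generated by $\sigma_1,\ldots,\sigma_{n-1}$ subject to $\sigma_i\sigma_j=\sigma_j\sigma_i$ for $|i-j|\geq 2$ and $\sigma_i\sigma_j\sigma_i=\sigma_j\sigma_i\sigma_j$ for $|i-j|=1$. Put $\Sigma_n=\{\sigma_i^{\pm1} : 1\leq i\leq n-1\}$. For $1\leq p<q\leq n$ put $a_{p,q}=\sigma_p\cdots\sigma_{q-2}\,\sigma_{q-1}\,\sigma_{q-2}^{-1}\cdots\sigma_p^{-1}$, and $\Sigma_n^{*}=\{a_{p,q}^{\pm1} : 1\leq p<q\leq n\}$. An $S_n$-word is a finite word on the alphabet $S_n$; $|u|$ is the length of the word $u$, $\overline{u}$ is the braid it represents, and $u\equiv v$ (equivalence) means $\overline{u}=\overline{v}$. The $S_n$-length $|\beta|_{S_n}$ of a braid $\beta$ is the length of a shortest $S_n$-word representing $\beta$; a word $u$ is geodesic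 if $|u|=|\overline{u}|_{S_n}$. $B_n(S_n,\ell)$ is the set of braids of $B_n$ of $S_n$-length $\ell$. $\omega_{S_n}(\beta)$ is the number of geodesic $S_n$-words representing $\beta$. A set $W$ of $S_n$-words represents a subset $X\subseteq B_n$ if $W$ is a set of unique geodesic representatives for $X$: every word of $W$ is geodesic and $u\mapsto\overline{u}$ is a bijection from $W$ to $X$. Algorithm RepSet, with input $(W_{\ell-1},W_{\ell-2})$: start with $W_\ell=\emptyset$. For each $x\in S_n$ and, for each such $x$, for each $u\in W_{\ell-1}$ (in any order), let $v=ux$. If $v$ is not equivalent to any word of $W_{\ell-2}$, then do the following: if $v$ is not equivalent to any word of the current set $W_\ell$, add $v$ to $W_\ell$ and set its label $v\cdot\omega:=u\cdot\omega$; otherwise let $w$ be the word of $W_\ell$ equivalent to $v$ and replace its label $w\cdot\omega$ by $w\cdot\omega+u\cdot\omega$. After both loops, return $W_\ell$ (with its labels). *)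

theory Defs
  imports "HOL-Algebra.Group"
begin

text \<open>
  The pair \<open>(i, True)\<close> stands for the generator with index \<open>i\<close>, and \<open>(i, False)\<close> for its formal
  inverse.  The group is given by its presentation: words in these symbols modulo the least
  congruence containing free cancellation and the braid relations.
\<close>

type_synonym artin_word = "(nat \<times> bool) list"

definition artin_words :: "nat \<Rightarrow> artin_word set" where
  "artin_words n = lists ({1..<n} \<times> UNIV)"

inductive_set braid_rel :: "nat \<Rightarrow> (artin_word \<times> artin_word) set" for n :: nat where
  refl: "u \<in> artin_words n \<Longrightarrow> (u, u) \<in> braid_rel n"
| sym: "(u, v) \<in> braid_rel n \<Longrightarrow> (v, u) \<in> braid_rel n"
| trans: "(u, v) \<in> braid_rel n \<Longrightarrow> (v, w) \<in> braid_rel n \<Longrightarrow> (u, w) \<in> braid_rel n"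
| append: "(u, u') \<in> braid_rel n \<Longrightarrow> (v, v') \<in> braid_rel n \<Longrightarrow> (u @ v, u' @ v') \<in> braid_rel n"
| cancel: "i \<in> {1..<n} \<Longrightarrow> ([(i, b), (i, \<not> b)], []) \<in> braid_rel n"
| commute: "i \<in> {1..<n} \<Longrightarrow> j \<in> {1..<n} \<Longrightarrow> \<bar>int i - int j\<bar> \<ge> 2 \<Longrightarrow>
    ([(i, True), (j, True)], [(j, True), (i, True)]) \<in> braid_rel n"
| braid: "i \<in> {1..<n} \<Longrightarrow> j \<in> {1..<n} \<Longrightarrow> \<bar>int i - int j\<bar> = 1 \<Longrightarrow>
    ([(i, True), (j, True), (i, True)], [(j, True), (i, True), (j, True)]) \<in> braid_rel n"

definition braid_group :: "nat \<Rightarrow> artin_word set monoid" where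
  "braid_group n =
     \<lparr>carrier = artin_words n // braid_rel n,
      mult = (\<lambda>X Y. braid_rel n `` {u @ v | u v. u \<in> X \<and> v \<in> Y}),
      one = braid_rel n `` {[]}\<rparr>"

lemma braid_rel_artin_words: "(u, v) \<in> braid_rel n \<Longrightarrow> u \<in> artin_words n \<and> v \<in> artin_words n"
  by (induction rule: braid_rel.induct) (auto simp: artin_words_def)

lemma equiv_braid_rel: "equiv (artin_words n) (braid_rel n)"
proof (rule equivI)
  show "braid_rel n \<subseteq> artin_words n \<times> artin_words n" using braid_rel_artin_words by auto
  show "refl_on (artin_words n) (braid_rel n)" by (simp add: refl_on_def braid_rel.refl)
  show "sym (braid_rel n)" by (rule symI) (rule braid_rel.sym)
  show "trans (braid_rel n)" by (rule transI) (rule braid_rel.trans)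
qed

lemma braid_group_carrier_iff:
  "X \<in> carrier (braid_group n) \<longleftrightarrow> (\<exists>u \<in> artin_words n. X = braid_rel n `` {u})"
  by (auto simp: braid_group_def quotient_def)

lemma braid_group_mult:
  assumes "u \<in> artin_words n" "v \<in> artin_words n"
  shows "(braid_rel n `` {u}) \<otimes>\<^bsub>braid_group n\<^esub> (braid_rel n `` {v}) = braid_rel n `` {u @ v}"
proof -
  have "(u @ v, w) \<in> braid_rel n"
    if "(u, u') \<in> braid_rel n" "(v, v') \<in> braid_rel n" "(u' @ v', w) \<in> braid_rel n" for u' v' w
    using braid_rel.trans[OF braid_rel.append[OF that(1,2)] that(3)] .
  moreover have "(u, u) \<in> braid_rel n" "(v, v) \<in> braid_rel n"
    using assms by (simp_all add: braid_rel.refl)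
  ultimately show ?thesis unfolding braid_group_def by (simp add: Image_def) blast
qed

lemma braid_rel_inverse:
  "u \<in> artin_words n \<Longrightarrow> (rev (map (apsnd Not) u) @ u, []) \<in> braid_rel n"
proof (induction u)
  case Nil
  then show ?case by (auto intro: braid_rel.refl)
next
  case (Cons x u)
  obtain i b where x: "x = (i, b)" by (cases x)
  have i: "i \<in> {1..<n}" and u: "u \<in> artin_words n"
    using Cons.prems by (auto simp: x artin_words_def)
  let ?r = "rev (map (apsnd Not) u)"
  have r: "?r \<in> artin_words n" using u by (fastforce simp: artin_words_def)
  have "([(i, \<not> b), (i, b)] @ u, [] @ u) \<in> braid_rel n"
    using braid_rel.append[OF braid_rel.cancel[OF i, of "\<not> b"] braid_rel.refl[OF u]] by simp
  from braid_rel.append[OF braid_rel.refl[OF r] this]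
  show ?case using braid_rel.trans[OF _ Cons.IH[OF u]] by (simp add: x)
qed

lemma group_braid_group: "group (braid_group n)"
proof (rule groupI)
  have nil: "[] \<in> artin_words n" by (simp add: artin_words_def)
  have app: "u @ v \<in> artin_words n" if "u \<in> artin_words n" "v \<in> artin_words n" for u v
    using that by (simp add: artin_words_def)
  have one: "\<one>\<^bsub>braid_group n\<^esub> = braid_rel n `` {[]}" by (simp add: braid_group_def)
  show "\<one>\<^bsub>braid_group n\<^esub> \<in> carrier (braid_group n)"
    unfolding one braid_group_carrier_iff using nil by blast
  fix X assume "X \<in> carrier (braid_group n)"
  then obtain u where u: "u \<in> artin_words n" and X: "X = braid_rel n `` {u}"
    by (auto simp: braid_group_carrier_iff)
  show "\<one>\<^bsub>braid_group n\<^esub> \<otimes>\<^bsub>braid_group n\<^esub> X = X"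
    by (simp add: X one braid_group_mult nil u)
  show "\<exists>Z \<in> carrier (braid_group n). Z \<otimes>\<^bsub>braid_group n\<^esub> X = \<one>\<^bsub>braid_group n\<^esub>"
  proof
    let ?r = "rev (map (apsnd Not) u)"
    have r: "?r \<in> artin_words n" using u by (fastforce simp: artin_words_def)
    show "braid_rel n `` {?r} \<otimes>\<^bsub>braid_group n\<^esub> X = \<one>\<^bsub>braid_group n\<^esub>"
      unfolding X braid_group_mult[OF r u] one
      by (rule equiv_class_eq[OF equiv_braid_rel braid_rel_inverse[OF u]])
    show "braid_rel n `` {?r} \<in> carrier (braid_group n)"
      unfolding braid_group_carrier_iff using r by blast
  qed
  fix Y assume "Y \<in> carrier (braid_group n)"
  then obtain v where v: "v \<in> artin_words n" and Y: "Y = braid_rel n `` {v}"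
    by (auto simp: braid_group_carrier_iff)
  show "X \<otimes>\<^bsub>braid_group n\<^esub> Y \<in> carrier (braid_group n)"
    unfolding X Y braid_group_mult[OF u v] braid_group_carrier_iff using app[OF u v] by blast
  fix Z assume "Z \<in> carrier (braid_group n)"
  then obtain w where w: "w \<in> artin_words n" and Z: "Z = braid_rel n `` {w}"
    by (auto simp: braid_group_carrier_iff)
  show "X \<otimes>\<^bsub>braid_group n\<^esub> Y \<otimes>\<^bsub>braid_group n\<^esub> Z = X \<otimes>\<^bsub>braid_group n\<^esub> (Y \<otimes>\<^bsub>braid_group n\<^esub> Z)"
    by (simp add: X Y Z braid_group_mult app u v w)
qed

type_synonym braid = "artin_word set"

text \<open>
  Letters are braids rather than formal symbols.  This makes no difference for the two alphabets
  below, whose elements as listed are pairwise distinct braids.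
\<close>

definition braid_of :: "nat \<Rightarrow> braid list \<Rightarrow> braid" where
  "braid_of n u = foldr (\<otimes>\<^bsub>braid_group n\<^esub>) u \<one>\<^bsub>braid_group n\<^esub>"

definition sigma :: "nat \<Rightarrow> nat \<Rightarrow> braid" where
  "sigma n i = braid_rel n `` {[(i, True)]}"

definition Sigma_gens :: "nat \<Rightarrow> braid set" where
  "Sigma_gens n = (\<Union>i \<in> {1..<n}. {sigma n i, inv\<^bsub>braid_group n\<^esub> (sigma n i)})"

definition dual_gen :: "nat \<Rightarrow> nat \<Rightarrow> nat \<Rightarrow> braid" where
  "dual_gen n p q = braid_of n
     (map (sigma n) [p..<q - 1] @ [sigma n (q - 1)] @
      map (\<lambda>i. inv\<^bsub>braid_group n\<^esub> (sigma n i)) (rev [p..<q - 1]))"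

definition Sigma_dual_gens :: "nat \<Rightarrow> braid set" where
  "Sigma_dual_gens n = (\<Union>(p, q) \<in> {(p, q). 1 \<le> p \<and> p < q \<and> q \<le> n}.
     {dual_gen n p q, inv\<^bsub>braid_group n\<^esub> (dual_gen n p q)})"

definition equivalent :: "nat \<Rightarrow> braid list \<Rightarrow> braid list \<Rightarrow> bool" where
  "equivalent n u v \<longleftrightarrow> braid_of n u = braid_of n v"

definition braid_length :: "nat \<Rightarrow> braid set \<Rightarrow> braid \<Rightarrow> nat" where
  "braid_length n S \<beta> = (LEAST k. \<exists>u \<in> lists S. braid_of n u = \<beta> \<and> length u = k)"

definition geodesic :: "nat \<Rightarrow> braid set \<Rightarrow> braid list \<Rightarrow> bool" where
  "geodesic n S u \<longleftrightarrow> u \<in> lists S \<and> length u = braid_length n S (braid_of n u)"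

definition braids_of_length :: "nat \<Rightarrow> braid set \<Rightarrow> nat \<Rightarrow> braid set" where
  "braids_of_length n S l = {\<beta> \<in> carrier (braid_group n). braid_length n S \<beta> = l}"

definition num_geodesics :: "nat \<Rightarrow> braid set \<Rightarrow> braid \<Rightarrow> nat" where
  "num_geodesics n S \<beta> = card {u. geodesic n S u \<and> braid_of n u = \<beta>}"

definition represents :: "nat \<Rightarrow> braid set \<Rightarrow> braid list set \<Rightarrow> braid set \<Rightarrow> bool" where
  "represents n S W X \<longleftrightarrow> (\<forall>u \<in> W. geodesic n S u) \<and> bij_betw (braid_of n) W X"

text \<open>
  A set of labelled words is a partial map from words to integers: the set is its domain, and the
  labels are its values.
\<close>

type_synonym labelled_words = "braid list \<rightharpoonup> int"

definition repset_step ::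
  "nat \<Rightarrow> labelled_words \<Rightarrow> braid list set \<Rightarrow> braid \<Rightarrow> braid list \<Rightarrow> labelled_words \<Rightarrow> labelled_words"
where
  "repset_step n W1 W2 x u W =
     (let v = u @ [x] in
      if \<exists>w \<in> W2. equivalent n v w then W
      else if \<not> (\<exists>w \<in> dom W. equivalent n v w) then W(v \<mapsto> the (W1 u))
      else let w = (THE w. w \<in> dom W \<and> equivalent n v w)
           in W(w \<mapsto> the (W w) + the (W1 u)))"

text \<open>
  The loops may be run in any order, so the algorithm is a relation between its input and its
  possible results: \<open>xs\<close> is the order in which the letters are visited, and \<open>us x\<close> the order in
  which the words of the first input set are visited for the letter \<open>x\<close>.
\<close>

definition repset_returns ::
  "nat \<Rightarrow> braid set \<Rightarrow> labelled_words \<Rightarrow> braid list set \<Rightarrow> labelled_words \<Rightarrow> bool"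
where
  "repset_returns n S W1 W2 W \<longleftrightarrow>
     (\<exists>xs us. distinct xs \<and> set xs = S \<and>
        (\<forall>x \<in> S. distinct (us x) \<and> set (us x) = dom W1) \<and>
        W = fold (\<lambda>x. fold (repset_step n W1 W2 x) (us x)) xs Map.empty)"

end

theory Submission
  imports Defs
begin

text \<open>
  All relators of the braid group have even length and every generator in either alphabet is
  represented by Artin words of odd length only, so the parity of an \<open>S\<close>-word depends only on the
  braid it represents.  Since the alphabet is closed under inverses, appending a letter to a
  geodesic word of length \<open>l - 1\<close> therefore yields a braid of length either \<open>l\<close> or \<open>l - 2\<close>, and
  the second case is precisely what the algorithm discards.  Every geodesic word of length \<open>l\<close>
  arises by appending a letter to a geodesic word of length \<open>l - 1\<close>; grouping geodesics by
  their last letter and the braid represented by their longest proper prefix gives the labels.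
\<close>

interpretation braid: group "braid_group n" for n
  by (rule group_braid_group)

section \<open>Parity of braids\<close>

text \<open>On braids this is the homomorphism to Z/2 that sends every \<open>sigma n i\<close> to
  1. The choice of a word in the class is harmless, because all words of a class have lengths of
  equal parity.\<close>

definition odd_braid :: "braid \<Rightarrow> bool" where
  "odd_braid X = odd (length (SOME u. u \<in> X))"

lemma braid_rel_even_length: "(u, v) \<in> braid_rel n \<Longrightarrow> even (length u) = even (length v)"
  by (induction rule: braid_rel.induct) auto

lemma odd_braid_class:
  assumes "u \<in> artin_words n"
  shows "odd_braid (braid_rel n `` {u}) = odd (length u)"
proof -
  have "(SOME v. v \<in> braid_rel n `` {u}) \<in> braid_rel n `` {u}"
    by (rule someI[of _ u]) (simp add: braid_rel.refl assms)
  then show ?thesis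
    unfolding odd_braid_def using braid_rel_even_length by blast
qed

lemma odd_braid_one: "\<not> odd_braid \<one>\<^bsub>braid_group n\<^esub>"
  using odd_braid_class[of "[]" n] by (simp add: braid_group_def artin_words_def)

lemma odd_braid_mult:
  assumes "X \<in> carrier (braid_group n)" "Y \<in> carrier (braid_group n)"
  shows "odd_braid (X \<otimes>\<^bsub>braid_group n\<^esub> Y) = (odd_braid X \<noteq> odd_braid Y)"
proof -
  obtain u v where uv: "u \<in> artin_words n" "v \<in> artin_words n"
    and XY: "X = braid_rel n `` {u}" "Y = braid_rel n `` {v}"
    using assms by (auto simp: braid_group_carrier_iff)
  have "u @ v \<in> artin_words n" using uv by (simp add: artin_words_def)
  then show ?thesis
    unfolding XY braid_group_mult[OF uv] using uv by (auto simp: odd_braid_class)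
qed

lemma odd_braid_inv:
  assumes "X \<in> carrier (braid_group n)"
  shows "odd_braid (inv\<^bsub>braid_group n\<^esub> X) = odd_braid X"
  using odd_braid_mult[OF assms braid.inv_closed[OF assms]] odd_braid_one[of n] assms
  by simp

section \<open>Words in braids\<close>

lemma braid_of_Nil [simp]: "braid_of n [] = \<one>\<^bsub>braid_group n\<^esub>"
  by (simp add: braid_of_def)

lemma braid_of_Cons [simp]: "braid_of n (x # u) = x \<otimes>\<^bsub>braid_group n\<^esub> braid_of n u"
  by (simp add: braid_of_def)

lemma braid_of_closed [simp]:
  "u \<in> lists (carrier (braid_group n)) \<Longrightarrow> braid_of n u \<in> carrier (braid_group n)"
  by (induction u) auto

lemma braid_of_snoc:
  "u \<in> lists (carrier (braid_group n)) \<Longrightarrow> x \<in> carrier (braid_group n) \<Longrightarrow>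
    braid_of n (u @ [x]) = braid_of n u \<otimes>\<^bsub>braid_group n\<^esub> x"
  by (induction u) (auto simp: braid.m_assoc)

lemma odd_braid_of:
  "u \<in> lists {x \<in> carrier (braid_group n). odd_braid x} \<Longrightarrow>
    odd_braid (braid_of n u) = odd (length u)"
proof (induction u)
  case Nil
  then show ?case by (simp add: odd_braid_one)
next
  case (Cons x u)
  then have "u \<in> lists (carrier (braid_group n))" by auto
  with Cons show ?case by (simp add: odd_braid_mult)
qed

section \<open>The two alphabets\<close>

lemma sigma_closed: "i \<in> {1..<n} \<Longrightarrow> sigma n i \<in> carrier (braid_group n)"
  unfolding sigma_def braid_group_carrier_iff by (auto simp: artin_words_def)

lemma odd_braid_sigma: "i \<in> {1..<n} \<Longrightarrow> odd_braid (sigma n i)"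
  unfolding sigma_def by (subst odd_braid_class) (auto simp: artin_words_def)

text \<open>Identifies the formal inverse of a generator with its group inverse, so that the class
  of every Artin letter is a letter of \<open>Sigma_gens n\<close>.\<close>

lemma inv_sigma:
  assumes "i \<in> {1..<n}"
  shows "inv\<^bsub>braid_group n\<^esub> (sigma n i) = braid_rel n `` {[(i, False)]}"
proof (rule braid.inv_equality)
  have w: "[(i, b)] \<in> artin_words n" for b using assms by (auto simp: artin_words_def)
  show "braid_rel n `` {[(i, False)]} \<otimes>\<^bsub>braid_group n\<^esub> sigma n i = \<one>\<^bsub>braid_group n\<^esub>"
    unfolding sigma_def braid_group_mult[OF w w]
    using equiv_class_eq[OF equiv_braid_rel braid_rel.cancel[OF assms, of False]]
    by (simp add: braid_group_def)
  show "braid_rel n `` {[(i, False)]} \<in> carrier (braid_group n)"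
    unfolding braid_group_carrier_iff using w by blast
qed (rule sigma_closed[OF assms])

lemma class_mem_braid_of_Sigma_gens:
  "u \<in> artin_words n \<Longrightarrow> braid_rel n `` {u} \<in> braid_of n ` lists (Sigma_gens n)"
proof (induction u)
  case Nil
  then show ?case by (intro image_eqI[of _ _ "[]"]) (auto simp: braid_group_def)
next
  case (Cons x u)
  obtain i b where x: "x = (i, b)" by (cases x)
  have i: "i \<in> {1..<n}" and u: "u \<in> artin_words n" and x': "[x] \<in> artin_words n"
    using Cons.prems by (auto simp: x artin_words_def)
  obtain w where w: "w \<in> lists (Sigma_gens n)" "braid_rel n `` {u} = braid_of n w"
    using Cons.IH[OF u] by blast
  let ?y = "braid_rel n `` {[x]}"
  have "?y \<in> Sigma_gens n"
    unfolding Sigma_gens_def using i inv_sigma[OF i]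
    by (cases b) (auto simp: x sigma_def)
  then have "?y # w \<in> lists (Sigma_gens n)" using w by simp
  moreover have "braid_rel n `` {x # u} = braid_of n (?y # w)"
    using braid_group_mult[OF x' u] w by simp
  ultimately show ?case by (rule rev_image_eqI)
qed

lemma dual_gen_Suc: "i \<in> {1..<n} \<Longrightarrow> dual_gen n i (Suc i) = sigma n i"
  by (simp add: dual_gen_def sigma_closed)

text \<open>For q = p + 1 the conjugating word is empty, so the dual generator is
  \<open>sigma n p\<close>. Through this inclusion generation passes from the small alphabet to the
  large one, while finiteness and oddness pass the other way.\<close>

lemma Sigma_gens_subset_dual: "Sigma_gens n \<subseteq> Sigma_dual_gens n"
proof
  fix x assume "x \<in> Sigma_gens n"
  then obtain i where "i \<in> {1..<n}" "x \<in> {sigma n i, inv\<^bsub>braid_group n\<^esub> (sigma n i)}"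
    by (auto simp: Sigma_gens_def)
  then show "x \<in> Sigma_dual_gens n"
    unfolding Sigma_dual_gens_def
    by (intro UN_I[of "(i, Suc i)"]) (auto simp: dual_gen_Suc)
qed

text \<open>The conjugating letters come in pairs around a single middle letter, which makes the
  defining word one of odd length in odd letters.\<close>

lemma dual_gen_odd_closed:
  assumes "1 \<le> p" "p < q" "q \<le> n"
  shows "dual_gen n p q \<in> {x \<in> carrier (braid_group n). odd_braid x}"
proof -
  let ?u = "map (sigma n) [p..<q - 1] @ [sigma n (q - 1)] @
      map (\<lambda>i. inv\<^bsub>braid_group n\<^esub> (sigma n i)) (rev [p..<q - 1])"
  have "q - 1 \<in> {1..<n}" using assms by auto
  then have u: "?u \<in> lists {x \<in> carrier (braid_group n). odd_braid x}"
    using assms sigma_closed[of "q - 1" n] odd_braid_sigma[of "q - 1" n] by (auto simp: sigma_closed odd_braid_sigma odd_braid_inv)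
  then have "?u \<in> lists (carrier (braid_group n))" by auto
  with odd_braid_of[OF u] braid_of_closed[OF this] show ?thesis
    by (simp add: dual_gen_def)
qed

section \<open>Lengths and geodesics\<close>

text \<open>These properties are shared by both alphabets and carry the whole argument, so the two
  cases are treated at once.\<close>

locale braid_alphabet =
  fixes n :: nat and S :: "braid set"
  assumes finite_S: "finite S"
    and S_odd: "S \<subseteq> {x \<in> carrier (braid_group n). odd_braid x}"
    and inv_S: "x \<in> S \<Longrightarrow> inv\<^bsub>braid_group n\<^esub> x \<in> S"
    and generates: "carrier (braid_group n) \<subseteq> braid_of n ` lists S"

lemma braid_alphabet_Sigma:
  assumes "S = Sigma_gens n \<or> S = Sigma_dual_gens n"
  shows "braid_alphabet n S"
proof
  have sub: "Sigma_gens n \<subseteq> S" "S \<subseteq> Sigma_dual_gens n"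
    using assms Sigma_gens_subset_dual by auto
  have "finite {(p, q). 1 \<le> p \<and> p < q \<and> q \<le> n}"
    by (rule finite_subset[of _ "{..n} \<times> {..n}"]) auto
  then have "finite (Sigma_dual_gens n)" by (auto simp: Sigma_dual_gens_def)
  with sub(2) show "finite S" by (rule finite_subset)
  have "Sigma_dual_gens n \<subseteq> {x \<in> carrier (braid_group n). odd_braid x}"
    using dual_gen_odd_closed[of _ _ n] by (auto simp: Sigma_dual_gens_def odd_braid_inv)
  with sub(2) show "S \<subseteq> {x \<in> carrier (braid_group n). odd_braid x}" by (rule order_trans)
  show "inv\<^bsub>braid_group n\<^esub> x \<in> S" if "x \<in> S" for x
    using assms
  proof
    assume "S = Sigma_gens n"
    then show ?thesis using that by (auto simp: Sigma_gens_def sigma_closed)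
  next
    assume "S = Sigma_dual_gens n"
    then show ?thesis using that dual_gen_odd_closed[of _ _ n]
      by (fastforce simp: Sigma_dual_gens_def)
  qed
  show "carrier (braid_group n) \<subseteq> braid_of n ` lists S"
  proof
    fix X assume "X \<in> carrier (braid_group n)"
    then have "X \<in> braid_of n ` lists (Sigma_gens n)"
      using class_mem_braid_of_Sigma_gens by (auto simp: braid_group_carrier_iff)
    then show "X \<in> braid_of n ` lists S" using lists_mono[OF sub(1)] by blast
  qed
qed

context braid_alphabet
begin

lemma letter_closed: "x \<in> S \<Longrightarrow> x \<in> carrier (braid_group n)"
  using S_odd by auto

lemma word_closed: "u \<in> lists S \<Longrightarrow> u \<in> lists (carrier (braid_group n))"
  using letter_closed by auto

lemma braid_length_le: "u \<in> lists S \<Longrightarrow> braid_length n S (braid_of n u) \<le> length u"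
  unfolding braid_length_def by (rule Least_le) auto

text \<open>Since \<open>S\<close> generates the group, the \<open>LEAST\<close> in
  \<open>braid_length\<close> ranges over a nonempty set and is attained.\<close>

lemma geodesic_exists:
  assumes "\<beta> \<in> carrier (braid_group n)"
  obtains u where "geodesic n S u" "braid_of n u = \<beta>"
proof -
  have "\<exists>k. \<exists>u \<in> lists S. braid_of n u = \<beta> \<and> length u = k"
    using generates assms by blast
  from LeastI_ex[OF this] show thesis
    using that unfolding geodesic_def braid_length_def by metis
qed

text \<open>All letters are odd, so \<open>u\<close> and any geodesic for the same braid have
  lengths of equal parity.\<close>

lemma even_braid_length:
  assumes "u \<in> lists S"
  shows "even (braid_length n S (braid_of n u)) = even (length u)"
proof -
  obtain v where v: "geodesic n S v" "braid_of n v = braid_of n u"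
    using geodesic_exists[OF braid_of_closed[OF word_closed[OF assms]]] .
  have odd: "odd_braid (braid_of n w) = odd (length w)" if "w \<in> lists S" for w
    using that S_odd by (intro odd_braid_of) auto
  show ?thesis using v odd[OF assms] odd[of v] by (auto simp: geodesic_def)
qed

lemma braid_of_snoc_letter:
  "u \<in> lists S \<Longrightarrow> x \<in> S \<Longrightarrow> braid_of n (u @ [x]) = braid_of n u \<otimes>\<^bsub>braid_group n\<^esub> x"
  by (simp add: braid_of_snoc word_closed letter_closed)

lemma braid_length_snoc_le:
  assumes "u \<in> lists S" "x \<in> S"
  shows "braid_length n S (braid_of n (u @ [x])) \<le> Suc (braid_length n S (braid_of n u))"
proof -
  obtain v where v: "geodesic n S v" "braid_of n v = braid_of n u"
    using geodesic_exists[OF braid_of_closed[OF word_closed[OF assms(1)]]] .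
  then have vS: "v \<in> lists S" by (simp add: geodesic_def)
  have "braid_of n (v @ [x]) = braid_of n (u @ [x])"
    using vS v assms by (simp add: braid_of_snoc_letter)
  with braid_length_le[of "v @ [x]"] vS assms v show ?thesis by (simp add: geodesic_def)
qed

text \<open>Right multiplication by the inverse of \<open>x\<close>, itself a letter, undoes the
  appending; the previous bound then applies to this second step.\<close>

lemma braid_length_le_snoc:
  assumes "u \<in> lists S" "x \<in> S"
  shows "braid_length n S (braid_of n u) \<le> Suc (braid_length n S (braid_of n (u @ [x])))"
proof -
  let ?y = "inv\<^bsub>braid_group n\<^esub> x"
  have "braid_of n ((u @ [x]) @ [?y]) = braid_of n (u @ [x]) \<otimes>\<^bsub>braid_group n\<^esub> ?y"
    using assms inv_S[of x] by (intro braid_of_snoc_letter) auto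
  also have "\<dots> = braid_of n u"
    using assms letter_closed[OF assms(2)] braid_of_closed[OF word_closed[OF assms(1)]]
    by (simp only: braid_of_snoc_letter) (simp add: braid.m_assoc)
  finally have "braid_of n ((u @ [x]) @ [?y]) = braid_of n u" .
  then show ?thesis
    using braid_length_snoc_le[of "u @ [x]" ?y] assms inv_S[of x] by simp
qed

text \<open>The two bounds allow a change of at most one, and parity forbids no change.
  \<open>Suc\<close> stands on the left of the second alternative so that it is false for empty
  \<open>u\<close>, where truncated subtraction would blur it.\<close>

lemma braid_length_snoc_cases:
  assumes "geodesic n S u" "x \<in> S"
  shows "braid_length n S (braid_of n (u @ [x])) = Suc (length u) \<or>
    Suc (braid_length n S (braid_of n (u @ [x]))) = length u"
proof -
  have u: "u \<in> lists S" "length u = braid_length n S (braid_of n u)"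
    using assms by (auto simp: geodesic_def)
  have "even (braid_length n S (braid_of n (u @ [x]))) \<noteq> even (length u)"
    using even_braid_length[of "u @ [x]"] u assms by simp
  with braid_length_snoc_le[OF u(1) assms(2)] braid_length_le_snoc[OF u(1) assms(2)] u(2)
  show ?thesis by presburger
qed

text \<open>A shorter word for the prefix would, followed by \<open>x\<close>, give a shorter word
  for the whole.\<close>

lemma geodesic_butlast:
  assumes "geodesic n S (u @ [x])"
  shows "geodesic n S u" "x \<in> S"
  using assms braid_length_snoc_le[of u x] braid_length_le[of u]
  by (auto simp: geodesic_def)

lemma finite_geodesics: "finite {u. geodesic n S u \<and> braid_of n u = \<beta>}"
proof (rule finite_subset)
  show "{u. geodesic n S u \<and> braid_of n u = \<beta>} \<subseteq>
      {u. set u \<subseteq> S \<and> length u = braid_length n S \<beta>}"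
    by (auto simp: geodesic_def)
  show "finite {u. set u \<subseteq> S \<and> length u = braid_length n S \<beta>}"
    by (rule finite_lists_length_eq[OF finite_S])
qed

section \<open>Sets of unique representatives and the recursive count of geodesics\<close>

lemma represents_length:
  assumes "represents n S W (braids_of_length n S k)" "u \<in> W"
  shows "geodesic n S u" "length u = k"
proof -
  show "geodesic n S u" using assms by (simp add: represents_def)
  moreover have "braid_of n u \<in> braids_of_length n S k"
    using assms by (auto simp: represents_def bij_betw_def)
  ultimately show "length u = k" by (simp add: geodesic_def braids_of_length_def)
qed

lemma represents_finite:
  assumes "represents n S W (braids_of_length n S k)"
  shows "finite W"
proof (rule finite_subset)
  show "W \<subseteq> {u. set u \<subseteq> S \<and> length u = k}"
    using represents_length[OF assms] by (auto simp: geodesic_def)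
  show "finite {u. set u \<subseteq> S \<and> length u = k}"
    by (rule finite_lists_length_eq[OF finite_S])
qed

lemma represents_equivalent:
  assumes "represents n S W (braids_of_length n S k)" "v \<in> lists S"
    "braid_length n S (braid_of n v) = k"
  obtains u where "u \<in> W" "braid_of n u = braid_of n v"
proof -
  have "braid_of n v \<in> braids_of_length n S k"
    using assms braid_of_closed[OF word_closed] by (simp add: braids_of_length_def)
  then have "braid_of n v \<in> braid_of n ` W"
    using assms(1) by (simp add: represents_def bij_betw_def)
  then show thesis using that by auto
qed

text \<open>The recursion behind the labels. Cutting off the last letter of a geodesic leaves a
  geodesic of length \<open>k\<close>, equivalent to exactly one \<open>u\<close> in
  \<open>W\<close>; conversely that prefix may be any geodesic equivalent to
  \<open>u\<close>.\<close>

lemma num_geodesics_eq_sum: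
  assumes W: "represents n S W (braids_of_length n S k)"
    and \<beta>: "braid_length n S \<beta> = Suc k"
  shows "num_geodesics n S \<beta> =
    (\<Sum>(x, u) \<in> {(x, u) \<in> S \<times> W. braid_of n (u @ [x]) = \<beta>}. num_geodesics n S (braid_of n u))"
proof -
  let ?P = "{(x, u) \<in> S \<times> W. braid_of n (u @ [x]) = \<beta>}"
  let ?G = "\<lambda>\<beta>. {w. geodesic n S w \<and> braid_of n w = \<beta>}"
  \<comment> \<open>The block of \<open>(x, u)\<close>: all words ending in \<open>x\<close> whose
    prefix is a geodesic equivalent to \<open>u\<close>.\<close>
  let ?A = "\<lambda>(x, u). (\<lambda>w. w @ [x]) ` ?G (braid_of n u)"
  have inj: "inj_on (braid_of n) W" using W by (simp add: represents_def bij_betw_def)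
  have "?G \<beta> = (\<Union>p \<in> ?P. ?A p)"
  proof (intro equalityI subsetI)
    fix w assume w: "w \<in> ?G \<beta>"
    then have len: "length w = Suc k" using \<beta> by (auto simp: geodesic_def)
    then obtain v x where w': "w = v @ [x]" by (cases w rule: rev_cases) auto
    have vx: "geodesic n S v" "x \<in> S" using geodesic_butlast[of v x] w w' by auto
    then have v: "v \<in> lists S" "braid_length n S (braid_of n v) = k"
      using len w' by (auto simp: geodesic_def)
    obtain u where u: "u \<in> W" "braid_of n u = braid_of n v"
      using represents_equivalent[OF W v] .
    have "u \<in> lists S" using represents_length(1)[OF W u(1)] by (simp add: geodesic_def)
    then have "braid_of n (u @ [x]) = \<beta>"
      using w w' v u vx by (simp add: braid_of_snoc_letter)
    then show "w \<in> (\<Union>p \<in> ?P. ?A p)"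
      using u vx by (intro UN_I[of "(x, u)"]) (auto simp: w')
  next
    fix w assume "w \<in> (\<Union>p \<in> ?P. ?A p)"
    then obtain x u v where x: "x \<in> S" and u: "u \<in> W" "braid_of n (u @ [x]) = \<beta>"
      and v: "geodesic n S v" "braid_of n v = braid_of n u" and w: "w = v @ [x]"
      by auto
    have S: "u \<in> lists S" "v \<in> lists S"
      using represents_length(1)[OF W u(1)] v by (auto simp: geodesic_def)
    \<comment> \<open>The word \<open>w\<close> has length \<open>Suc k\<close>, the length of the
      braid it represents, and is therefore geodesic.\<close>
    have "length v = k"
      using represents_length[OF W u(1)] v by (simp add: geodesic_def)
    moreover have "braid_of n w = \<beta>"
      using S x u v by (simp add: w braid_of_snoc_letter)
    ultimately show "w \<in> ?G \<beta>" using S x \<beta> by (simp add: w geodesic_def)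
  qed
  then have "num_geodesics n S \<beta> = card (\<Union>p \<in> ?P. ?A p)"
    by (simp add: num_geodesics_def)
  also have "\<dots> = (\<Sum>p \<in> ?P. card (?A p))"
  proof (rule card_UN_disjoint)
    show "finite ?P"
      by (rule finite_subset[of _ "S \<times> W"]) (auto simp: finite_S represents_finite[OF W])
    show "\<forall>p \<in> ?P. finite (?A p)" using finite_geodesics by auto
    show "\<forall>p \<in> ?P. \<forall>q \<in> ?P. p \<noteq> q \<longrightarrow> ?A p \<inter> ?A q = {}"
    proof (intro ballI impI, rule ccontr)
      fix p q assume pq: "p \<in> ?P" "q \<in> ?P" "p \<noteq> q" "?A p \<inter> ?A q \<noteq> {}"
      obtain x u y t where xy: "p = (x, u)" "q = (y, t)" by fastforce
      \<comment> \<open>A common word fixes its last letter and its prefix, hence the braid of the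
        prefix; injectivity on \<open>W\<close> then identifies \<open>u\<close> and
        \<open>t\<close>.\<close>
      then have "x = y" "braid_of n u = braid_of n t" using pq(4) by auto
      then show False using pq xy inj_onD[OF inj, of u t] by simp
    qed
  qed
  also have "\<dots> = (\<Sum>(x, u) \<in> ?P. num_geodesics n S (braid_of n u))"
    by (rule sum.cong) (auto simp: num_geodesics_def card_image inj_on_def)
  finally show ?thesis .
qed

end

section \<open>The algorithm\<close>

text \<open>Flattens the nested loops, so that a single induction over a list of pairs covers every
  order of visiting.\<close>

lemma fold_fold_eq_fold_pairs:
  "fold (\<lambda>x. fold (f x) (g x)) xs =
    fold (\<lambda>(x, y). f x y) (concat (map (\<lambda>x. map (Pair x) (g x)) xs))"
  by (induction xs) (auto simp: fold_map comp_def)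

lemma distinct_concat_map_Pair:
  assumes "distinct xs" "\<And>x. x \<in> set xs \<Longrightarrow> distinct (g x)"
  shows "distinct (concat (map (\<lambda>x. map (Pair x) (g x)) xs))"
  using assms by (induction xs) (auto simp: distinct_map inj_on_def)

text \<open>The loop invariant, independent of any fact about lengths: \<open>V\<close> holds the
  candidates not discarded so far, \<open>dom W\<close> one candidate for each braid they represent.
  The label sum may run over all visited pairs, because discarding depends only on the braid: no
  discarded candidate is equivalent to a stored word.\<close>

lemma fold_repset_step:
  fixes n :: nat and W1 :: labelled_words and W2 :: "braid list set"
    and ps :: "(braid \<times> braid list) list"
  assumes "distinct ps"
  defines "V \<equiv> {u @ [x] | x u. (x, u) \<in> set ps} - {v. \<exists>w \<in> W2. equivalent n v w}"
  defines "W \<equiv> fold (\<lambda>(x, u). repset_step n W1 W2 x u) ps Map.empty"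
  shows "dom W \<subseteq> V \<and> bij_betw (braid_of n) (dom W) (braid_of n ` V) \<and>
    (\<forall>w \<in> dom W. the (W w) =
      (\<Sum>(x, u) \<in> {(x, u) \<in> set ps. braid_of n (u @ [x]) = braid_of n w}. the (W1 u)))"
  using assms(1) unfolding V_def W_def
\<comment> \<open>\<open>fold\<close> runs from left to right, so the pair appended on the right is
  the latest iteration.\<close>
proof (induction ps rule: rev_induct)
  case Nil
  then show ?case by (simp add: bij_betw_def)
next
  case (snoc p ps)
  obtain x u where p: "p = (x, u)" by (cases p)
  let ?v = "u @ [x]"
  let ?bad = "{v. \<exists>w \<in> W2. equivalent n v w}"
  let ?V = "\<lambda>ps. {u @ [x] | x u. (x, u) \<in> set ps} - ?bad"
  let ?P = "\<lambda>ps \<beta>. {(x, u) \<in> set ps. braid_of n (u @ [x]) = \<beta>}"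
  let ?s = "\<lambda>ps w. \<Sum>(x, u) \<in> ?P ps (braid_of n w). the (W1 u)"
  define W where "W = fold (\<lambda>(x, u). repset_step n W1 W2 x u) ps Map.empty"
  have IH: "dom W \<subseteq> ?V ps" "inj_on (braid_of n) (dom W)"
      "braid_of n ` dom W = braid_of n ` ?V ps" "\<And>w. w \<in> dom W \<Longrightarrow> the (W w) = ?s ps w"
    using snoc by (auto simp: W_def bij_betw_def)
  \<comment> \<open>Distinctness enters here: the new pair contributes a summand not yet
    counted.\<close>
  have p_notin: "(x, u) \<notin> set ps" using snoc.prems p by simp
  have fin: "finite (?P ps \<beta>)" for \<beta> by (rule finite_subset[of _ "set ps"]) auto
  have P: "?P (ps @ [p]) \<beta> = (if braid_of n ?v = \<beta> then insert (x, u) (?P ps \<beta>) else ?P ps \<beta>)" for \<beta>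
    by (auto simp: p)
  have s: "?s (ps @ [p]) w = ?s ps w + (if braid_of n ?v = braid_of n w then the (W1 u) else 0)" for w
    unfolding P using fin p_notin by auto
  have V: "?V (ps @ [p]) = (if ?v \<in> ?bad then ?V ps else insert ?v (?V ps))"
    by (auto simp: p)
  have W': "fold (\<lambda>(x, u). repset_step n W1 W2 x u) (ps @ [p]) Map.empty = repset_step n W1 W2 x u W"
    by (simp add: W_def p)
  \<comment> \<open>Stored words are inequivalent to all words of \<open>W2\<close>, so a discarded
    candidate affects no label sum.\<close>
  have bad: "braid_of n w \<noteq> braid_of n ?v" if "?v \<in> ?bad" "w \<in> dom W" for w
    using that IH(1) by (fastforce simp: equivalent_def)
  \<comment> \<open>The three branches of one step: the candidate is discarded, represents a new
    braid, or is merged with a stored word.\<close>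
  consider "?v \<in> ?bad"
    | "?v \<notin> ?bad" "\<not> (\<exists>w \<in> dom W. equivalent n ?v w)"
    | w where "?v \<notin> ?bad" "w \<in> dom W" "equivalent n ?v w" by blast
  then show ?case
  proof cases
    case 1
    then have "repset_step n W1 W2 x u W = W" by (simp add: repset_step_def)
    moreover have "the (W w) = ?s (ps @ [p]) w" if "w \<in> dom W" for w
      using bad[OF 1 that] IH(4)[OF that] unfolding s by simp
    ultimately show ?thesis unfolding W' V using 1 IH by (simp add: bij_betw_def)
  next
    case 2
    then have step: "repset_step n W1 W2 x u W = W(?v \<mapsto> the (W1 u))"
      by (simp add: repset_step_def)
    have new: "braid_of n w \<noteq> braid_of n ?v" if "w \<in> dom W" for w
      using 2(2) that by (auto simp: equivalent_def)
    \<comment> \<open>An earlier pair with the same braid would have survived as well, leaving an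
      equivalent word in \<open>dom W\<close>. The initial label is thus the entire sum.\<close>
    have empty: "?P ps (braid_of n ?v) = {}"
    proof (rule ccontr)
      assume "?P ps (braid_of n ?v) \<noteq> {}"
      then obtain y t where yt: "(y, t) \<in> set ps" "braid_of n (t @ [y]) = braid_of n ?v" by auto
      then have "t @ [y] \<in> ?V ps" using 2(1) by (auto simp: equivalent_def)
      then have "braid_of n ?v \<in> braid_of n ` dom W"
        unfolding IH(3) yt(2)[symmetric] by (rule imageI)
      then show False using new by auto
    qed
    have "?s (ps @ [p]) ?v = the (W1 u)" unfolding s empty by simp
    moreover have "the (W w) = ?s (ps @ [p]) w" if "w \<in> dom W" for w
      using new[OF that] IH(4)[OF that] unfolding s by simp
    ultimately have "\<forall>w \<in> insert ?v (dom W). the ((W(?v \<mapsto> the (W1 u))) w) = ?s (ps @ [p]) w"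
      using new by auto
    moreover have "inj_on (braid_of n) (insert ?v (dom W))"
      using IH(2) new by (auto simp: inj_on_def)
    ultimately show ?thesis
      unfolding W' V step using 2(1) IH(1,3) by (auto simp: bij_betw_def simp del: fun_upd_apply)
  next
    case 3
    \<comment> \<open>Injectivity on \<open>dom W\<close> makes the equivalent stored word unique;
      it is also the only one whose label sum gains a term.\<close>
    have the_w: "(THE w. w \<in> dom W \<and> equivalent n ?v w) = w"
      using 3 IH(2) by (intro the_equality) (auto simp: equivalent_def dest: inj_onD)
    have step: "repset_step n W1 W2 x u W = W(w \<mapsto> the (W w) + the (W1 u))"
      using 3 the_w by (auto simp: repset_step_def Let_def)
    have eq: "braid_of n ?v = braid_of n w" using 3 by (simp add: equivalent_def)
    have "the ((W(w \<mapsto> the (W w) + the (W1 u))) w') = ?s (ps @ [p]) w'" if "w' \<in> dom W" for w'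
      using IH(4)[OF that] inj_onD[OF IH(2) _ 3(2) that] unfolding s eq by auto
    moreover have "braid_of n ?v \<in> braid_of n ` ?V ps"
      unfolding eq IH(3)[symmetric] using 3 by blast
    ultimately show ?thesis
      unfolding W' V step using 3 IH(1-3)
      by (simp add: bij_betw_def insert_absorb del: fun_upd_apply) blast
  qed
qed

section \<open>Correctness of the algorithm for both alphabets\<close>

theorem proposition3p8:
  fixes n l :: nat and S :: "braid set"
    and W1 :: labelled_words and W2 :: "braid list set"
  assumes "n \<ge> 2" and "S = Sigma_gens n \<or> S = Sigma_dual_gens n" and "l \<ge> 2"
    and "represents n S (dom W1) (braids_of_length n S (l - 1))"
    and "represents n S W2 (braids_of_length n S (l - 2))"
    and "\<And>u. u \<in> dom W1 \<Longrightarrow> the (W1 u) = int (num_geodesics n S (braid_of n u))"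
  shows "(\<exists>W. repset_returns n S W1 W2 W) \<and>
    (\<forall>W. repset_returns n S W1 W2 W \<longrightarrow>
       represents n S (dom W) (braids_of_length n S l) \<and>
       (\<forall>u \<in> dom W. the (W u) = int (num_geodesics n S (braid_of n u))))"
proof (intro conjI allI impI)
  interpret braid_alphabet n S using assms(2) by (rule braid_alphabet_Sigma)
  note R1 = assms(4) and R2 = assms(5)
  \<comment> \<open>The letters and the words of the first input set are finite in number, hence can
    be enumerated. A run exists, and the claim about all results is not vacuous.\<close>
  obtain xs where xs: "distinct xs" "set xs = S"
    using finite_distinct_list[OF finite_S] by blast
  obtain us where us: "distinct us" "set us = dom W1"
    using finite_distinct_list[OF represents_finite[OF R1]] by blast
  show "\<exists>W. repset_returns n S W1 W2 W"
    unfolding repset_returns_def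
    by (rule exI, rule exI[of _ xs], rule exI[of _ "\<lambda>_. us"]) (use xs us in blast)
  fix W assume "repset_returns n S W1 W2 W"
  then obtain xs us where xs: "distinct xs" "set xs = S"
    and us: "\<And>x. x \<in> S \<Longrightarrow> distinct (us x)" "\<And>x. x \<in> S \<Longrightarrow> set (us x) = dom W1"
    and W: "W = fold (\<lambda>x. fold (repset_step n W1 W2 x) (us x)) xs Map.empty"
    unfolding repset_returns_def by blast
  define ps where "ps = concat (map (\<lambda>x. map (Pair x) (us x)) xs)"
  \<comment> \<open>Every order of the loops visits each pair of the same product exactly once; the
    chosen order matters no further.\<close>
  have ps: "distinct ps" "set ps = S \<times> dom W1"
    using distinct_concat_map_Pair[of xs us] xs us by (auto simp: ps_def)
  define V where "V = {u @ [x] | x u. (x, u) \<in> set ps} - {v. \<exists>w \<in> W2. equivalent n v w}"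
  have fold: "dom W \<subseteq> V" "bij_betw (braid_of n) (dom W) (braid_of n ` V)"
    "\<And>w. w \<in> dom W \<Longrightarrow> the (W w) =
      (\<Sum>(x, u) \<in> {(x, u) \<in> set ps. braid_of n (u @ [x]) = braid_of n w}. the (W1 u))"
    using fold_repset_step[OF ps(1), of n W1 W2]
    unfolding W fold_fold_eq_fold_pairs ps_def[symmetric] V_def[symmetric] by blast+
  \<comment> \<open>A candidate has length \<open>l\<close> or \<open>l - 2\<close>, and in the
    second case \<open>W2\<close> contains an equivalent word, so it was discarded.\<close>
  have V: "v \<in> lists S \<and> length v = l \<and> braid_length n S (braid_of n v) = l" if v: "v \<in> V" for v
  proof -
    obtain x u where xu: "v = u @ [x]" "x \<in> S" "u \<in> dom W1"
      using v ps(2) by (auto simp: V_def)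
    have u: "geodesic n S u" "length u = l - 1" using represents_length[OF R1 xu(3)] .
    then have vS: "v \<in> lists S" using xu by (simp add: geodesic_def)
    have "braid_length n S (braid_of n v) \<noteq> l - 2"
    proof
      assume "braid_length n S (braid_of n v) = l - 2"
      from represents_equivalent[OF R2 vS this] obtain w where "w \<in> W2" "braid_of n w = braid_of n v" .
      then show False using v by (auto simp: V_def equivalent_def)
    qed
    with braid_length_snoc_cases[OF u(1) xu(2)] u(2) xu(1) vS assms(3) show ?thesis by auto
  qed
  have "braid_of n ` V = braids_of_length n S l"
  proof (intro equalityI subsetI)
    fix \<beta> assume "\<beta> \<in> braid_of n ` V"
    then show "\<beta> \<in> braids_of_length n S l"
      using V braid_of_closed[OF word_closed] by (auto simp: braids_of_length_def)
  next
    fix \<beta> assume \<beta>: "\<beta> \<in> braids_of_length n S l"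
    then obtain w where w: "geodesic n S w" "braid_of n w = \<beta>"
      using geodesic_exists[of \<beta>] by (auto simp: braids_of_length_def)
    then have len: "length w = l" using \<beta> by (simp add: geodesic_def braids_of_length_def)
    then obtain v x where w': "w = v @ [x]" using assms(3) by (cases w rule: rev_cases) auto
    have vx: "geodesic n S v" "x \<in> S" using geodesic_butlast[of v x] w w' by auto
    then have v: "v \<in> lists S" "braid_length n S (braid_of n v) = l - 1"
      using len w' by (auto simp: geodesic_def)
    \<comment> \<open>The prefix of a geodesic need not lie in \<open>dom W1\<close>; replacing it
      by its representative there gives a candidate for the same braid.\<close>
    obtain u where u: "u \<in> dom W1" "braid_of n u = braid_of n v"
      using represents_equivalent[OF R1 v] .
    have "u \<in> lists S" using represents_length(1)[OF R1 u(1)] by (simp add: geodesic_def)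
    then have eq: "braid_of n (u @ [x]) = \<beta>"
      using w w' v u vx by (simp add: braid_of_snoc_letter)
    \<comment> \<open>Words of \<open>W2\<close> represent braids of length \<open>l - 2\<close>,
      which differs from \<open>l\<close> since \<open>l\<close> is at least 2.\<close>
    have "\<not> equivalent n (u @ [x]) t" if "t \<in> W2" for t
      using represents_length[OF R2 that] \<beta> assms(3) eq
      by (auto simp: equivalent_def geodesic_def braids_of_length_def)
    then have "u @ [x] \<in> V" using u vx ps(2) by (auto simp: V_def)
    then show "\<beta> \<in> braid_of n ` V" using eq by blast
  qed
  then show "represents n S (dom W) (braids_of_length n S l)"
    using fold(1,2) V[OF subsetD[OF fold(1)]] by (simp add: represents_def geodesic_def)
  show "\<forall>w \<in> dom W. the (W w) = int (num_geodesics n S (braid_of n w))"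
  proof
    fix w assume w: "w \<in> dom W"
    let ?P = "{(x, u) \<in> S \<times> dom W1. braid_of n (u @ [x]) = braid_of n w}"
    \<comment> \<open>The length \<open>l\<close> is rewritten to fit the counting recursion over
      words of length \<open>l - 1\<close>, whose sum has the same index set as the label
      sum.\<close>
    have "braid_length n S (braid_of n w) = Suc (l - 1)" using V fold(1) w assms(3) by auto
    note num = num_geodesics_eq_sum[OF R1 this]
    have "the (W w) = (\<Sum>(x, u) \<in> ?P. the (W1 u))" using fold(3)[OF w] by (simp only: ps(2))
    also have "\<dots> = (\<Sum>(x, u) \<in> ?P. int (num_geodesics n S (braid_of n u)))"
      using assms(6) by (intro sum.cong) auto
    also have "\<dots> = int (num_geodesics n S (braid_of n w))"
      unfolding num by (simp add: case_prod_unfold)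
    finally show "the (W w) = int (num_geodesics n S (braid_of n w))" .
  qed
qed

end
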